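(* Let $l,D_{ax},v,k,n>0$ and $\alpha\in[0,\tfrac12]$, and let $\overline{C}_A$ be the steady-state solution defined in the context. Consider the problem $$\frac{\partial w}{\partial t}=D_{ax}\frac{\partial^2 w}{\partial x^2}-v\frac{\partial w}{\partial x}+k\,\overline{C}_A^{\,n}-k\,(w+\overline{C}_A)^n,\qquad (x,t)\in(0,l)\times(0,T),$$ $$w(0,t)=u_w(t)+\frac{D_{ax}}{v}\frac{\partial w}{\partial x}\Big|_{x=0},\qquad \frac{\partial w}{\partial x}\Big|_{x=l}=0,$$ with the boundary feedback control $u_w(t)=\alpha\,w(0,t)$. Then the trivial solution $w\equiv 0$ of this problem is exponentially stable in the weighted Lebesgue space $L^2_\rho(0,l)$: there exist constants $K\geqslant 1$ and $\lambda>0$, independent of $T$ and of the solution, such that for every $T>0$ every solution $w$ satisfies $$\|w(\cdot,t)\|_{L^2_\rho(0,l)}\leqslant K e^{-\lambda t}\,\|w(\cdot,0)\|_{L^2_\rho(0,l)},\qquad t\in[0,T].$$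
   Context: All functions are real-valued. The constants are: $l>0$ (reactor length), $D_{ax}>0$ (axial dispersion coefficient), $v>0$ (flow rate), $k>0$ (reaction rate constant), $n>0$ (reaction order), $\alpha\in[0,\tfrac12]$ (feedback gain). Steady state: $\overline{C}_A\in C^2[0,l]$ is a solution of $$D_{ax}\overline{C}_A''=v\,\overline{C}_A'+k\,\overline{C}_A^{\,n}\ \text{ on }(0,l),\qquad \overline{C}_A(0)=\overline{u}+\tfrac{D_{ax}}{v}\overline{C}_A'(0),\qquad \overline{C}_A'(l)=0,$$ where $\overline{u}>0$ is a constant selected so that $\overline{C}_A(x)\geqslant 0$ for all $x\in[0,l]$. The function $w$ is the deviation $w(x,t)=C_A(x,t)-\overline{C}_A(x)$ of a reactant concentration $C_A$ from the steady state. Standing assumption: only nonnegative concentrations are considered, i.e. $w+\overline{C}_A=C_A\geqslant 0$ for almost all $(x,t)\in(0,l)\times(0,T)$. Weighted space: the weight is $\rho(x)=\rho_0e^{-\gamma x}$, $x\in[0,l]$, with $\rho_0>0$ a constant and $\gamma=\frac{v}{2D_{ax}}$ (i.e. $\rho'=-\gamma\rho$, $\rho(0)=\rho_0$), and $\|f\|_{L^2_\rho(0,l)}=\left(\int_0^l\rho(x)f(x)^2\,dx\right)^{1/2}$. *)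

theory Defs
  imports "HOL-Analysis.Analysis"
begin

definition rho :: "real \<Rightarrow> real \<Rightarrow> real \<Rightarrow> real \<Rightarrow> real" where
  "rho rho0 D v x = rho0 * exp (- (v / (2 * D)) * x)"

definition in_L2w :: "(real \<Rightarrow> real) \<Rightarrow> real \<Rightarrow> (real \<Rightarrow> real) \<Rightarrow> bool" where
  "in_L2w r l f \<longleftrightarrow>
     set_borel_measurable lebesgue {0<..<l} f \<and>
     set_integrable lebesgue {0<..<l} (\<lambda>x. r x * (f x)\<^sup>2)"

definition norm_L2w :: "(real \<Rightarrow> real) \<Rightarrow> real \<Rightarrow> (real \<Rightarrow> real) \<Rightarrow> real" where
  "norm_L2w r l f = sqrt (LINT x:{0<..<l}|lebesgue. r x * (f x)\<^sup>2)"

text \<open>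
  A twice continuously differentiable function on the closed interval; derivatives at the
  end points are one-sided. The reaction order is real, so powers are written with \<open>powr\<close>;
  they are only applied to nonnegative concentrations (and \<open>0 powr n = 0\<close>).
\<close>

definition steady_state ::
  "real \<Rightarrow> real \<Rightarrow> real \<Rightarrow> real \<Rightarrow> real \<Rightarrow> real \<Rightarrow> (real \<Rightarrow> real) \<Rightarrow> bool" where
  "steady_state l D v k n u C \<longleftrightarrow>
     (\<exists>C' C''.
        (\<forall>x\<in>{0..l}. (C has_real_derivative C' x) (at x within {0..l})) \<and>
        (\<forall>x\<in>{0..l}. (C' has_real_derivative C'' x) (at x within {0..l})) \<and>
        continuous_on {0..l} C'' \<and>
        (\<forall>x\<in>{0<..<l}. D * C'' x = v * C' x + k * C x powr n) \<and>
        C 0 = u + D / v * C' 0 \<and>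
        C' l = 0)"

text \<open>
  Solutions of the controlled deviation problem on \<open>(0,l) \<times> (0,T)\<close>, with \<open>w x t\<close> for
  the deviation and \<open>uw t\<close> for the boundary control. The differential equation and the boundary
  conditions hold pointwise: \<open>w\<close> is of class \<open>C\<^sup>2\<close> in \<open>x\<close> and \<open>C\<^sup>1\<close> in \<open>t\<close> on the open
  rectangle, and \<open>w\<close> and its space derivative are continuous up to \<open>x = 0\<close> and \<open>x = l\<close>
  (one-sided derivatives there). The values at the times \<open>0\<close> and \<open>T\<close> are attained only in
  the sense of continuity of \<open>t \<mapsto> w(\<cdot>,t)\<close> into the weighted Lebesgue space, so that the initial
  state may be an arbitrary element of that space, not necessarily compatible with the
  boundary conditions.
\<close>

definition deviation_solution ::
  "(real \<Rightarrow> real) \<Rightarrow> real \<Rightarrow> real \<Rightarrow> real \<Rightarrow> real \<Rightarrow> real \<Rightarrow> real \<Rightarrow> (real \<Rightarrow> real)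
    \<Rightarrow> (real \<Rightarrow> real) \<Rightarrow> (real \<Rightarrow> real \<Rightarrow> real) \<Rightarrow> bool" where
  "deviation_solution r l T D v k n C uw w \<longleftrightarrow>
     (\<exists>w_t w_x w_xx.
        (\<forall>x\<in>{0..l}. \<forall>t\<in>{0<..<T}.
           ((\<lambda>y. w y t) has_real_derivative w_x x t) (at x within {0..l})) \<and>
        (\<forall>x\<in>{0<..<l}. \<forall>t\<in>{0<..<T}.
           ((\<lambda>y. w_x y t) has_real_derivative w_xx x t) (at x) \<and>
           ((\<lambda>s. w x s) has_real_derivative w_t x t) (at t)) \<and>
        continuous_on ({0..l} \<times> {0<..<T}) (\<lambda>(x, t). w x t) \<and>
        continuous_on ({0..l} \<times> {0<..<T}) (\<lambda>(x, t). w_x x t) \<and>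
        continuous_on ({0<..<l} \<times> {0<..<T}) (\<lambda>(x, t). w_xx x t) \<and>
        continuous_on ({0<..<l} \<times> {0<..<T}) (\<lambda>(x, t). w_t x t) \<and>
        (\<forall>x\<in>{0<..<l}. \<forall>t\<in>{0<..<T}.
           w_t x t = D * w_xx x t - v * w_x x t + k * C x powr n - k * (w x t + C x) powr n) \<and>
        (\<forall>t\<in>{0<..<T}. w 0 t = uw t + D / v * w_x 0 t) \<and>
        (\<forall>t\<in>{0<..<T}. w_x l t = 0)) \<and>
     (\<forall>t\<in>{0..T}. in_L2w r l (\<lambda>x. w x t)) \<and>
     (\<forall>s\<in>{0..T}. ((\<lambda>t. norm_L2w r l (\<lambda>x. w x t - w x s)) \<longlongrightarrow> 0) (at s within {0..T}))"

definition nonneg_concentration ::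
  "real \<Rightarrow> real \<Rightarrow> (real \<Rightarrow> real) \<Rightarrow> (real \<Rightarrow> real \<Rightarrow> real) \<Rightarrow> bool" where
  "nonneg_concentration l T C w \<longleftrightarrow>
     (AE (x, t) in (lborel :: (real \<times> real) measure).
        x \<in> {0<..<l} \<and> t \<in> {0<..<T} \<longrightarrow> 0 \<le> w x t + C x)"

end

theory Submission
  imports Defs
begin

text \<open>
  The Lyapunov function is the weighted energy \<open>E t = \<integral> \<rho> w\<^sup>2\<close>. Multiply the equation by
  \<open>\<rho> w\<close> and integrate by parts. The weight satisfies \<open>\<rho>' = -(v / 2D) \<rho>\<close>; half of the convection term
  is thereby cancelled, and the other half, \<open>-(v/2) \<rho> w w_x = -(v/4) \<rho> (w\<^sup>2)_x\<close>, is again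
  integrated by parts and produces the damping \<open>-(v\<^sup>2 / 8D) \<rho> w\<^sup>2\<close>. What is left has a sign:
  diffusion gives \<open>-D \<rho> w_x\<^sup>2\<close>; the reaction term is dissipative because \<open>s \<mapsto> s\<^sup>n\<close> is
  increasing on nonnegative concentrations; and the boundary flux
  \<open>G = \<rho> (D w w_x - (v/4) w\<^sup>2)\<close> is nonpositive at the outlet, where \<open>w_x = 0\<close>, and
  nonnegative at the inlet, where the feedback makes it \<open>\<rho> v (3/4 - \<alpha>) w\<^sup>2\<close>. So
  \<open>E' \<le> -2 \<lambda> E\<close> with \<open>\<lambda> = v\<^sup>2 / 8D\<close>, and the stability estimate holds with \<open>K = 1\<close>.

  Two passages to the limit make this rigorous. The derivatives \<open>w_t\<close> and \<open>w_xx\<close> are controlled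
  only inside the rectangle, so \<open>E\<close> itself need not be differentiable. The argument is run for
  the energy on \<open>[d, l - d]\<close> (\<open>weighted_energy_inequality\<close>), whose boundary terms are almost of the
  right sign, uniformly on compact time intervals, by uniform continuity of \<open>G\<close>; then \<open>d \<rightarrow> 0\<close>
  (\<open>weighted_energy_decay\<close>). The times \<open>0\<close> and \<open>T\<close> are reached only in the weighted norm, and
  the triangle inequality turns that into continuity of \<open>t \<mapsto> \<parallel>w(\<cdot>,t)\<parallel>\<close> on \<open>[0, T]\<close>
  (\<open>norm_L2w_tendsto\<close>).
\<close>

section \<open>The weighted Lebesgue norm\<close>

text \<open>
  The weighted form of Young's inequality. With the free parameter \<open>d\<close> it yields the triangle
  inequality below directly, without first proving a Cauchy--Schwarz inequality.
\<close>

lemma square_add_le_weighted: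
  fixes a b d :: real
  assumes "d > 0"
  shows "(a + b)\<^sup>2 \<le> (1 + d) * a\<^sup>2 + (1 + 1 / d) * b\<^sup>2"
proof -
  have "0 \<le> (d * a - b)\<^sup>2 / d"
    using assms by simp
  also have "\<dots> = (1 + d) * a\<^sup>2 + (1 + 1 / d) * b\<^sup>2 - (a + b)\<^sup>2"
    using assms by (simp add: field_simps power2_eq_square)
  finally show ?thesis by simp
qed

lemma rho_nonneg: "rho0 > 0 \<Longrightarrow> 0 \<le> rho rho0 D v x"
  by (simp add: rho_def)

lemma continuous_on_rho [continuous_intros]:
  "continuous_on S f \<Longrightarrow> continuous_on S (\<lambda>x. rho rho0 D v (f x))"
  unfolding rho_def by (intro continuous_intros)

lemma rho_has_derivative:
  "(rho rho0 D v has_real_derivative - (v / (2 * D)) * rho rho0 D v x) (at x within S)"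
  unfolding rho_def by (rule derivative_eq_intros refl)+ simp

lemma norm_L2w_power2:
  assumes "\<And>x. 0 \<le> r x"
  shows "(norm_L2w r l f)\<^sup>2 = (LINT x:{0<..<l}|lebesgue. r x * (f x)\<^sup>2)"
  unfolding norm_L2w_def set_lebesgue_integral_def using assms by simp

lemma in_L2w_diff:
  assumes r: "\<And>x. 0 \<le> r x" "continuous_on UNIV r"
    and f: "in_L2w r l f" and g: "in_L2w r l g"
  shows "in_L2w r l (\<lambda>x. f x - g x)"
proof -
  let ?S = "{0<..<l}"
  have mf: "set_borel_measurable lebesgue ?S f" and mg: "set_borel_measurable lebesgue ?S g"
    and If: "set_integrable lebesgue ?S (\<lambda>x. r x * (f x)\<^sup>2)"
    and Ig: "set_integrable lebesgue ?S (\<lambda>x. r x * (g x)\<^sup>2)"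
    using f g unfolding in_L2w_def by auto
  have "(\<lambda>x. indicator ?S x *\<^sub>R f x - indicator ?S x *\<^sub>R g x) \<in> borel_measurable lebesgue"
    using mf mg unfolding set_borel_measurable_def by (rule borel_measurable_diff)
  then have md: "(\<lambda>x. indicator ?S x *\<^sub>R (f x - g x)) \<in> borel_measurable lebesgue"
    by (simp add: algebra_simps)
  have "r \<in> borel_measurable borel"
    using r(2) by (rule borel_measurable_continuous_onI)
  then have mr: "r \<in> borel_measurable lebesgue"
    by (simp add: measurable_completion)
  have "(\<lambda>x. r x * (indicator ?S x *\<^sub>R (f x - g x))\<^sup>2) \<in> borel_measurable lebesgue"
    using mr md by measurable
  also have "(\<lambda>x. r x * (indicator ?S x *\<^sub>R (f x - g x))\<^sup>2)
      = (\<lambda>x. indicator ?S x *\<^sub>R (r x * (f x - g x)\<^sup>2))"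
    by (auto simp: indicator_def)
  finally have msq: "set_borel_measurable lebesgue ?S (\<lambda>x. r x * (f x - g x)\<^sup>2)"
    unfolding set_borel_measurable_def .
  have "set_integrable lebesgue ?S (\<lambda>x. r x * (f x - g x)\<^sup>2)"
  proof (rule set_integrable_bound[OF _ msq])
    show "set_integrable lebesgue ?S (\<lambda>x. 2 * (r x * (f x)\<^sup>2) + 2 * (r x * (g x)\<^sup>2))"
      using If Ig by (intro set_integral_add set_integrable_mult_right) auto
    show "AE x in lebesgue. x \<in> ?S \<longrightarrow>
      norm (r x * (f x - g x)\<^sup>2) \<le> norm (2 * (r x * (f x)\<^sup>2) + 2 * (r x * (g x)\<^sup>2))"
    proof (intro AE_I2 impI)
      fix x
      have "(f x - g x)\<^sup>2 \<le> 2 * (f x)\<^sup>2 + 2 * (g x)\<^sup>2"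
        using square_add_le_weighted[of 1 "f x" "- g x"] by simp
      then have "r x * (f x - g x)\<^sup>2 \<le> r x * (2 * (f x)\<^sup>2 + 2 * (g x)\<^sup>2)"
        using r(1) by (rule mult_left_mono)
      then show "norm (r x * (f x - g x)\<^sup>2) \<le> norm (2 * (r x * (f x)\<^sup>2) + 2 * (r x * (g x)\<^sup>2))"
        using r(1)[of x] by (simp add: algebra_simps)
    qed
  qed
  with md show ?thesis
    unfolding in_L2w_def set_borel_measurable_def by simp
qed

text \<open>
  Integrating \<open>(g + (f - g))\<^sup>2 \<le> (1 + d) g\<^sup>2 + (1 + 1/d) (f - g)\<^sup>2\<close> and choosing
  \<open>d = \<parallel>f - g\<parallel> / \<parallel>g\<parallel>\<close> makes the right side \<open>(\<parallel>g\<parallel> + \<parallel>f - g\<parallel>)\<^sup>2\<close>.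
\<close>

lemma norm_L2w_triangle:
  assumes r: "\<And>x. 0 \<le> r x" "continuous_on UNIV r"
    and f: "in_L2w r l f" and g: "in_L2w r l g"
  shows "norm_L2w r l f \<le> norm_L2w r l g + norm_L2w r l (\<lambda>x. f x - g x)"
proof -
  let ?F = "norm_L2w r l f" and ?G = "norm_L2w r l g" and ?H = "norm_L2w r l (\<lambda>x. f x - g x)"
  have GH: "?G \<ge> 0" "?H \<ge> 0"
    using r(1) by (auto simp: norm_L2w_def set_lebesgue_integral_def)
  have weighted: "?F\<^sup>2 \<le> (1 + d) * ?G\<^sup>2 + (1 + 1 / d) * ?H\<^sup>2" if d: "d > 0" for d
  proof -
    have ints: "set_integrable lebesgue {0<..<l} (\<lambda>x. r x * (f x)\<^sup>2)"
      "set_integrable lebesgue {0<..<l} (\<lambda>x. (1 + d) * (r x * (g x)\<^sup>2))"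
      "set_integrable lebesgue {0<..<l} (\<lambda>x. (1 + 1 / d) * (r x * (f x - g x)\<^sup>2))"
      using f g in_L2w_diff[OF r f g] unfolding in_L2w_def
      by (auto intro: set_integrable_mult_right)
    have "?F\<^sup>2 \<le> (LINT x:{0<..<l}|lebesgue.
        (1 + d) * (r x * (g x)\<^sup>2) + (1 + 1 / d) * (r x * (f x - g x)\<^sup>2))"
      unfolding norm_L2w_power2[OF r(1)]
    proof (rule set_integral_mono[OF ints(1) set_integral_add(1)[OF ints(2,3)]])
      fix x
      have "r x * (g x + (f x - g x))\<^sup>2
          \<le> r x * ((1 + d) * (g x)\<^sup>2 + (1 + 1 / d) * (f x - g x)\<^sup>2)"
        using r(1) square_add_le_weighted[OF d] by (rule mult_left_mono[rotated])
      then show "r x * (f x)\<^sup>2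
          \<le> (1 + d) * (r x * (g x)\<^sup>2) + (1 + 1 / d) * (r x * (f x - g x)\<^sup>2)"
        by (simp add: algebra_simps)
    qed
    also have "\<dots> = (1 + d) * ?G\<^sup>2 + (1 + 1 / d) * ?H\<^sup>2"
      unfolding norm_L2w_power2[OF r(1)] set_integral_add(2)[OF ints(2,3)] by simp
    finally show ?thesis .
  qed
  show ?thesis
  proof (rule field_le_epsilon)
    fix e :: real
    assume e: "e > 0"
    \<comment> \<open>The shift by \<open>e / 2\<close> keeps the optimal ratio \<open>b / a\<close> meaningful when a norm vanishes.\<close>
    define a where "a = ?G + e / 2"
    define b where "b = ?H + e / 2"
    have ab: "a > 0" "b > 0" "?G\<^sup>2 \<le> a\<^sup>2" "?H\<^sup>2 \<le> b\<^sup>2"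
      using GH e by (auto simp: a_def b_def intro!: power_mono)
    have "?F\<^sup>2 \<le> (1 + b / a) * ?G\<^sup>2 + (1 + 1 / (b / a)) * ?H\<^sup>2"
      using ab by (intro weighted) simp
    also have "\<dots> \<le> (1 + b / a) * a\<^sup>2 + (1 + 1 / (b / a)) * b\<^sup>2"
      using ab by (intro add_mono mult_left_mono) auto
    also have "\<dots> = (a + b)\<^sup>2"
      using ab by (simp add: field_simps power2_eq_square)
    finally have "?F \<le> a + b"
      by (rule power2_le_imp_le) (use ab in simp)
    then show "?F \<le> ?G + ?H + e"
      by (simp add: a_def b_def)
  qed
qed

lemma norm_L2w_tendsto:
  assumes r: "\<And>x. 0 \<le> r x" "continuous_on UNIV r"
    and L2: "\<forall>t\<in>S. in_L2w r l (\<lambda>x. w x t)" and s: "s \<in> S"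
    and lim: "((\<lambda>t. norm_L2w r l (\<lambda>x. w x t - w x s)) \<longlongrightarrow> 0) (at s within S)"
  shows "((\<lambda>t. norm_L2w r l (\<lambda>x. w x t)) \<longlongrightarrow> norm_L2w r l (\<lambda>x. w x s)) (at s within S)"
proof (rule LIM_zero_cancel, rule tendsto_0_le[OF lim, where K = 1])
  have "\<bar>norm_L2w r l (\<lambda>x. w x t) - norm_L2w r l (\<lambda>x. w x s)\<bar>
      \<le> norm_L2w r l (\<lambda>x. w x t - w x s)" if "t \<in> S" for t
  proof -
    have "norm_L2w r l (\<lambda>x. w x s - w x t) = norm_L2w r l (\<lambda>x. w x t - w x s)"
      unfolding norm_L2w_def by (simp add: power2_commute)
    then show ?thesis
      using norm_L2w_triangle[OF r L2[rule_format, OF that] L2[rule_format, OF s]]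
        norm_L2w_triangle[OF r L2[rule_format, OF s] L2[rule_format, OF that]]
      by simp
  qed
  then show "\<forall>\<^sub>F t in at s within S.
      norm (norm_L2w r l (\<lambda>x. w x t) - norm_L2w r l (\<lambda>x. w x s))
        \<le> norm (norm_L2w r l (\<lambda>x. w x t - w x s)) * 1"
    unfolding eventually_at_filter by (intro always_eventually) fastforce
qed

section \<open>Dissipation of the weighted energy\<close>

text \<open>
  The energy balance at a fixed time: \<open>f\<close> stands for \<open>w(\<cdot>,t)\<close>, \<open>g\<close> for \<open>w_t(\<cdot>,t)\<close> and \<open>q\<close> for the
  reaction. The flux \<open>G\<close> is chosen so that
  \<open>G' = \<rho> (f (D f'' - v f') + D f'\<^sup>2 + (v\<^sup>2 / 8D) f\<^sup>2)\<close>: the \<open>f f'\<close> terms coming from \<open>\<rho>'\<close> and from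
  \<open>f\<^sup>2\<close> add up to the whole convection term. Dropping \<open>D f'\<^sup>2\<close> and \<open>f q\<close>, both
  nonnegative, leaves the inequality.
\<close>

lemma weighted_energy_inequality:
  fixes f f' f'' g q :: "real \<Rightarrow> real"
  assumes D: "D > 0" and rho0: "rho0 > 0" and ab: "a \<le> b"
    and f': "\<And>x. x \<in> {a..b} \<Longrightarrow> (f has_real_derivative f' x) (at x)"
    and f'': "\<And>x. x \<in> {a..b} \<Longrightarrow> (f' has_real_derivative f'' x) (at x)"
    and g: "continuous_on {a..b} g"
    and eq: "\<And>x. x \<in> {a..b} \<Longrightarrow> g x = D * f'' x - v * f' x - q x"
    and q: "\<And>x. x \<in> {a..b} \<Longrightarrow> 0 \<le> f x * q x"
  defines "G \<equiv> \<lambda>x. rho rho0 D v x * (D * f x * f' x - v / 4 * (f x)\<^sup>2)"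
  shows "integral {a..b} (\<lambda>x. rho rho0 D v x * (f x * g x))
    \<le> G b - G a - v\<^sup>2 / (8 * D) * integral {a..b} (\<lambda>x. rho rho0 D v x * (f x)\<^sup>2)"
proof -
  define H where "H x = rho rho0 D v x *
    (f x * (D * f'' x - v * f' x) + D * (f' x)\<^sup>2 + v\<^sup>2 / (8 * D) * (f x)\<^sup>2)" for x
  have "(H has_integral G b - G a) {a..b}"
  proof (rule fundamental_theorem_of_calculus[OF ab])
    fix x assume x: "x \<in> {a..b}"
    have "(G has_real_derivative
        rho rho0 D v x * ((D * f' x * f' x + D * f x * f'' x) - v / 4 * (2 * f x * f' x))
        + (- (v / (2 * D)) * rho rho0 D v x) * (D * f x * f' x - v / 4 * (f x)\<^sup>2)) (at x)"
      unfolding G_def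
      by (rule derivative_eq_intros rho_has_derivative f'[OF x] f''[OF x] refl)+ 
        (simp add: algebra_simps)
    also have "rho rho0 D v x * ((D * f' x * f' x + D * f x * f'' x) - v / 4 * (2 * f x * f' x))
        + (- (v / (2 * D)) * rho rho0 D v x) * (D * f x * f' x - v / 4 * (f x)\<^sup>2) = H x"
      using D unfolding H_def by (simp add: field_simps power2_eq_square)
    finally show "(G has_vector_derivative H x) (at x within {a..b})"
      by (simp add: has_real_derivative_iff_has_vector_derivative
          has_vector_derivative_at_within)
  qed
  then have HI: "H integrable_on {a..b}" "integral {a..b} H = G b - G a"
    by (auto simp: has_integral_integrable_integral)
  have contf: "continuous_on {a..b} f"
    using f' by (meson DERIV_isCont continuous_at_imp_continuous_on)
  have If: "(\<lambda>x. rho rho0 D v x * (f x)\<^sup>2) integrable_on {a..b}"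
    by (intro integrable_continuous_interval continuous_intros contf)
  have "integral {a..b} (\<lambda>x. rho rho0 D v x * (f x * g x))
      \<le> integral {a..b} (\<lambda>x. H x - v\<^sup>2 / (8 * D) * (rho rho0 D v x * (f x)\<^sup>2))"
  proof (rule integral_le)
    show "(\<lambda>x. rho rho0 D v x * (f x * g x)) integrable_on {a..b}"
      by (intro integrable_continuous_interval continuous_intros contf g)
    show "(\<lambda>x. H x - v\<^sup>2 / (8 * D) * (rho rho0 D v x * (f x)\<^sup>2)) integrable_on {a..b}"
      by (intro integrable_diff HI integrable_on_mult_right If)
    fix x assume x: "x \<in> {a..b}"
    have "f x * g x \<le> f x * (D * f'' x - v * f' x) + D * (f' x)\<^sup>2"
      using q[OF x] D by (simp add: eq[OF x] algebra_simps)
    from mult_left_mono[OF this rho_nonneg[OF rho0, of D v x]]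
    show "rho rho0 D v x * (f x * g x)
        \<le> H x - v\<^sup>2 / (8 * D) * (rho rho0 D v x * (f x)\<^sup>2)"
      unfolding H_def by (simp add: algebra_simps)
  qed
  also have "\<dots> = G b - G a - v\<^sup>2 / (8 * D) * integral {a..b} (\<lambda>x. rho rho0 D v x * (f x)\<^sup>2)"
    unfolding integral_diff[OF HI(1) integrable_on_mult_right[OF If]] HI(2) by simp
  finally show ?thesis .
qed

text \<open>
  The differential inequality for the energy, in integrated form, for an arbitrary reaction term
  \<open>q\<close> with \<open>w q \<ge> 0\<close>. The energy on \<open>[d, l - d]\<close> can be differentiated under the integral sign;
  once \<open>d\<close> is so small that its boundary terms contribute at most \<open>2 e\<close>, it satisfies
  \<open>E_d' \<le> 4 e - 2 \<lambda> E_d\<close>, that is, \<open>exp (2 \<lambda> \<tau>) (E_d - 2 e / \<lambda>)\<close> is nonincreasing.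
\<close>

lemma weighted_energy_decay:
  fixes w w_t w_x w_xx q :: "real \<Rightarrow> real \<Rightarrow> real"
  assumes l: "l > 0" and D: "D > 0" and v: "v > 0" and rho0: "rho0 > 0" and \<alpha>: "\<alpha> \<le> 1 / 2"
    and st: "S < s" "s \<le> t" "t < T"
    and wx: "\<And>x \<tau>. x \<in> {0<..<l} \<Longrightarrow> \<tau> \<in> {S<..<T} \<Longrightarrow>
        ((\<lambda>y. w y \<tau>) has_real_derivative w_x x \<tau>) (at x)"
    and wxx: "\<And>x \<tau>. x \<in> {0<..<l} \<Longrightarrow> \<tau> \<in> {S<..<T} \<Longrightarrow>
        ((\<lambda>y. w_x y \<tau>) has_real_derivative w_xx x \<tau>) (at x)"
    and wt: "\<And>x \<tau>. x \<in> {0<..<l} \<Longrightarrow> \<tau> \<in> {S<..<T} \<Longrightarrow>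
        ((\<lambda>\<sigma>. w x \<sigma>) has_real_derivative w_t x \<tau>) (at \<tau>)"
    and cw: "continuous_on ({0..l} \<times> {S<..<T}) (\<lambda>(x, \<tau>). w x \<tau>)"
    and cwx: "continuous_on ({0..l} \<times> {S<..<T}) (\<lambda>(x, \<tau>). w_x x \<tau>)"
    and cwt: "continuous_on ({0<..<l} \<times> {S<..<T}) (\<lambda>(x, \<tau>). w_t x \<tau>)"
    and eq: "\<And>x \<tau>. x \<in> {0<..<l} \<Longrightarrow> \<tau> \<in> {S<..<T} \<Longrightarrow>
        w_t x \<tau> = D * w_xx x \<tau> - v * w_x x \<tau> - q x \<tau>"
    and q: "\<And>x \<tau>. x \<in> {0<..<l} \<Longrightarrow> \<tau> \<in> {S<..<T} \<Longrightarrow> 0 \<le> w x \<tau> * q x \<tau>"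
    and inlet: "\<And>\<tau>. \<tau> \<in> {S<..<T} \<Longrightarrow> w 0 \<tau> = \<alpha> * w 0 \<tau> + D / v * w_x 0 \<tau>"
    and outlet: "\<And>\<tau>. \<tau> \<in> {S<..<T} \<Longrightarrow> w_x l \<tau> = 0"
  defines "lam \<equiv> v\<^sup>2 / (8 * D)"
    and "E \<equiv> \<lambda>\<tau>. integral {0..l} (\<lambda>x. rho rho0 D v x * (w x \<tau>)\<^sup>2)"
  shows "exp (2 * lam * t) * E t \<le> exp (2 * lam * s) * E s"
proof -
  have lam: "lam > 0"
    using D v by (simp add: lam_def)
  define G where "G x \<tau> = rho rho0 D v x * (D * w x \<tau> * w_x x \<tau> - v / 4 * (w x \<tau>)\<^sup>2)" for x \<tau>
  define Ed where "Ed d \<tau> = integral {d..l - d} (\<lambda>x. rho rho0 D v x * (w x \<tau>)\<^sup>2)" for d \<tau>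

  \<comment> \<open>The feedback law and the inlet condition give \<open>D w_x = v (1 - \<alpha>) w\<close> at \<open>x = 0\<close>.\<close>
  have G0: "0 \<le> G 0 \<tau>" if "\<tau> \<in> {S<..<T}" for \<tau>
  proof -
    have flux: "D * w_x 0 \<tau> = v * (1 - \<alpha>) * w 0 \<tau>"
      using inlet[OF that] D v by (simp add: field_simps)
    have "G 0 \<tau> = rho rho0 D v 0 * (w 0 \<tau> * (D * w_x 0 \<tau>) - v / 4 * (w 0 \<tau>)\<^sup>2)"
      by (simp add: G_def)
    then have "G 0 \<tau> = rho rho0 D v 0 * (v * (3 / 4 - \<alpha>) * (w 0 \<tau>)\<^sup>2)"
      unfolding flux by (simp add: algebra_simps power2_eq_square)
    then show ?thesis
      using v \<alpha> rho_nonneg[OF rho0] by simp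
  qed
  have Gl: "G l \<tau> \<le> 0" if "\<tau> \<in> {S<..<T}" for \<tau>
    unfolding G_def using outlet[OF that] v rho_nonneg[OF rho0]
    by (simp add: mult_nonneg_nonneg)

  have cw': "continuous_on ({0..l} \<times> {S<..<T}) (\<lambda>z. w (fst z) (snd z))"
    and cwx': "continuous_on ({0..l} \<times> {S<..<T}) (\<lambda>z. w_x (fst z) (snd z))"
    and cwt': "continuous_on ({0<..<l} \<times> {S<..<T}) (\<lambda>z. w_t (fst z) (snd z))"
    using cw cwx cwt by (simp_all add: case_prod_unfold)
  have cw1: "continuous_on X (\<lambda>x. w x \<tau>)" if "X \<subseteq> {0..l}" "\<tau> \<in> {S<..<T}" for X \<tau>
    by (rule continuous_on_compose2[OF cw', where f = "\<lambda>x. (x, \<tau>)", unfolded fst_conv snd_conv])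
      (use that in \<open>auto intro!: continuous_intros\<close>)
  have cwt1: "continuous_on X (\<lambda>x. w_t x \<tau>)" if "X \<subseteq> {0<..<l}" "\<tau> \<in> {S<..<T}" for X \<tau>
    by (rule continuous_on_compose2[OF cwt', where f = "\<lambda>x. (x, \<tau>)", unfolded fst_conv snd_conv])
      (use that in \<open>auto intro!: continuous_intros\<close>)
  have Iw: "(\<lambda>x. rho rho0 D v x * (w x \<tau>)\<^sup>2) integrable_on {a..b}"
    if "{a..b} \<subseteq> {0..l}" "\<tau> \<in> {S<..<T}" for a b \<tau>
    by (intro integrable_continuous_interval continuous_intros cw1 that)

  have dEd: "(Ed d has_real_derivative
      2 * integral {d..l - d} (\<lambda>x. rho rho0 D v x * (w x \<tau> * w_t x \<tau>))) (at \<tau>)"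
    if d: "0 < d" and \<tau>: "\<tau> \<in> {S<..<T}" for d \<tau>
  proof -
    have sub: "{d..l - d} \<subseteq> {0<..<l}" "{d..l - d} \<subseteq> {0..l}"
      using d by auto
    have "((\<lambda>\<tau>. integral (cbox d (l - d)) (\<lambda>x. rho rho0 D v x * (w x \<tau>)\<^sup>2))
        has_field_derivative
        integral (cbox d (l - d)) (\<lambda>x. 2 * (rho rho0 D v x * (w x \<tau> * w_t x \<tau>))))
        (at \<tau> within {S<..<T})"
    proof (rule leibniz_rule_field_derivative)
      fix \<sigma> x
      assume \<sigma>: "\<sigma> \<in> {S<..<T}" and "x \<in> cbox d (l - d)"
      then have x: "x \<in> {0<..<l}"
        using d by auto
      have "((\<lambda>\<sigma>. rho rho0 D v x * (w x \<sigma>)\<^sup>2) has_field_derivative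
        2 * (rho rho0 D v x * (w x \<sigma> * w_t x \<sigma>))) (at \<sigma>)"
        by (rule derivative_eq_intros wt[OF x \<sigma>] refl)+ simp
      then show "((\<lambda>\<sigma>. rho rho0 D v x * (w x \<sigma>)\<^sup>2) has_field_derivative
        2 * (rho rho0 D v x * (w x \<sigma> * w_t x \<sigma>))) (at \<sigma> within {S<..<T})"
        by (rule has_field_derivative_at_within)
    next
      show "(\<lambda>x. rho rho0 D v x * (w x \<sigma>)\<^sup>2) integrable_on cbox d (l - d)"
        if "\<sigma> \<in> {S<..<T}" for \<sigma>
        using Iw[OF sub(2) that] by simp
    next
      have "continuous_on ({S<..<T} \<times> {d..l - d}) (\<lambda>z. w (snd z) (fst z))"
        by (rule continuous_on_compose2[OF cw', where f = "\<lambda>z. (snd z, fst z)", unfolded fst_conv snd_conv])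
          (use sub in \<open>auto intro!: continuous_intros\<close>)
      moreover have "continuous_on ({S<..<T} \<times> {d..l - d}) (\<lambda>z. w_t (snd z) (fst z))"
        by (rule continuous_on_compose2[OF cwt', where f = "\<lambda>z. (snd z, fst z)", unfolded fst_conv snd_conv])
          (use sub in \<open>auto intro!: continuous_intros\<close>)
      ultimately show "continuous_on ({S<..<T} \<times> cbox d (l - d))
          (\<lambda>(\<tau>, x). 2 * (rho rho0 D v x * (w x \<tau> * w_t x \<tau>)))"
        unfolding case_prod_unfold by (auto intro!: continuous_intros)
    qed (use \<tau> in auto)
    moreover have "at \<tau> within {S<..<T} = at \<tau>"
      using \<tau> by (intro at_within_open) auto
    ultimately show ?thesis
      unfolding Ed_def by simp
  qed

  have decay_eps: "exp (2 * lam * t) * (E t - 2 * e / lam) \<le> exp (2 * lam * s) * (E s - 2 * e / lam)"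
    if e: "e > 0" for e
  proof -
    \<comment> \<open>Uniform continuity of the flux makes its values at \<open>d\<close> and \<open>l - d\<close> close to those at the
      ends of the reactor for all times in \<open>[s, t]\<close> simultaneously.\<close>
    have "continuous_on ({0..l} \<times> {s..t}) (\<lambda>z. G (fst z) (snd z))"
      unfolding G_def using st
      by (intro continuous_intros continuous_on_subset[OF cw'] continuous_on_subset[OF cwx']) auto
    then have "uniformly_continuous_on ({0..l} \<times> {s..t}) (\<lambda>z. G (fst z) (snd z))"
      by (intro compact_uniformly_continuous compact_Times) auto
    then obtain d0 where d0: "d0 > 0"
      and close: "\<And>y z. \<lbrakk>y \<in> {0..l} \<times> {s..t}; z \<in> {0..l} \<times> {s..t}; dist z y < d0\<rbrakk> \<Longrightarrow>
        dist (G (fst z) (snd z)) (G (fst y) (snd y)) < e"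
      unfolding uniformly_continuous_on_def using e by metis

    have step: "exp (2 * lam * t) * (Ed d t - 2 * e / lam)
        \<le> exp (2 * lam * s) * (Ed d s - 2 * e / lam)"
      if d: "0 < d" "d < d0" "d < l / 2" for d
    proof (rule DERIV_nonpos_imp_nonincreasing[OF st(2)], intro exI conjI)
      fix \<tau>
      assume \<tau>: "s \<le> \<tau>" "\<tau> \<le> t"
      then have \<tau>': "\<tau> \<in> {S<..<T}"
        using st by auto
      let ?I = "integral {d..l - d} (\<lambda>x. rho rho0 D v x * (w x \<tau> * w_t x \<tau>))"
      show "((\<lambda>\<tau>. exp (2 * lam * \<tau>) * (Ed d \<tau> - 2 * e / lam)) has_real_derivative
          exp (2 * lam * \<tau>) * (2 * lam * (Ed d \<tau> - 2 * e / lam) + 2 * ?I)) (at \<tau>)"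
        by (rule derivative_eq_intros dEd[OF d(1) \<tau>'] refl)+ (simp add: algebra_simps)
      have "?I \<le> G (l - d) \<tau> - G d \<tau> - lam * Ed d \<tau>"
        unfolding G_def lam_def Ed_def
        by (rule weighted_energy_inequality[OF D rho0, where f'' = "\<lambda>x. w_xx x \<tau>" and q = "\<lambda>x. q x \<tau>"])
          (use d \<tau>' in \<open>auto intro!: wx wxx eq q cwt1\<close>)
      moreover have "G (l - d) \<tau> \<le> e"
        using close[of "(l, \<tau>)" "(l - d, \<tau>)"] Gl[OF \<tau>'] d \<tau> by (auto simp: dist_Pair_Pair dist_real_def)
      moreover have "- e \<le> G d \<tau>"
        using close[of "(0, \<tau>)" "(d, \<tau>)"] G0[OF \<tau>'] d \<tau> by (auto simp: dist_Pair_Pair dist_real_def)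
      ultimately have "2 * lam * (Ed d \<tau> - 2 * e / lam) + 2 * ?I \<le> 0"
        using lam by (simp add: algebra_simps)
      then show "exp (2 * lam * \<tau>) * (2 * lam * (Ed d \<tau> - 2 * e / lam) + 2 * ?I) \<le> 0"
        by (simp add: mult_nonneg_nonpos)
    qed

    have Ed_lim: "((\<lambda>d. Ed d \<tau>) \<longlongrightarrow> E \<tau>) (at_right 0)" if \<tau>: "\<tau> \<in> {S<..<T}" for \<tau>
    proof -
      let ?f = "\<lambda>x. rho rho0 D v x * (w x \<tau>)\<^sup>2"
      let ?P = "\<lambda>x. integral {0..x} ?f"
      have cP: "continuous_on {0..l} ?P"
        using Iw[of 0 l, OF _ \<tau>] by (intro indefinite_integral_continuous_1) auto
      have ev: "\<forall>\<^sub>F d in at_right 0. 0 < d \<and> d < l / 2"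
        using l eventually_at_right_less[of 0] eventually_at_right_real[of 0 "l / 2"]
        by (auto elim: eventually_mono)
      have "((\<lambda>d. ?P (l - d) - ?P d) \<longlongrightarrow> ?P l - ?P 0) (at_right 0)"
      proof (intro tendsto_diff)
        show "((\<lambda>d. ?P (l - d)) \<longlongrightarrow> ?P l) (at_right 0)"
        proof (rule continuous_on_tendsto_compose[OF cP])
          show "((\<lambda>d. l - d) \<longlongrightarrow> l) (at_right 0)"
            by (auto intro!: tendsto_eq_intros)
        qed (use l ev in \<open>auto elim: eventually_mono\<close>)
        show "((\<lambda>d. ?P d) \<longlongrightarrow> ?P 0) (at_right 0)"
          by (rule continuous_on_tendsto_compose[OF cP])
            (use l ev in \<open>auto elim: eventually_mono\<close>)
      qed
      then have "((\<lambda>d. ?P (l - d) - ?P d) \<longlongrightarrow> E \<tau>) (at_right 0)"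
        by (simp add: E_def)
      moreover have "\<forall>\<^sub>F d in at_right 0. ?P (l - d) - ?P d = Ed d \<tau>"
        using ev
      proof eventually_elim
        case (elim d)
        then have "?P d + integral {d..l - d} ?f = ?P (l - d)"
          using Iw[of 0 "l - d", OF _ \<tau>] by (intro Henstock_Kurzweil_Integration.integral_combine) auto
        then show ?case
          by (simp add: Ed_def)
      qed
      ultimately show ?thesis
        by (rule Lim_transform_eventually)
    qed
    show ?thesis
    proof (rule tendsto_le)
      show "((\<lambda>d. exp (2 * lam * s) * (Ed d s - 2 * e / lam))
          \<longlongrightarrow> exp (2 * lam * s) * (E s - 2 * e / lam)) (at_right 0)"
        using st by (intro tendsto_intros Ed_lim) auto
      show "((\<lambda>d. exp (2 * lam * t) * (Ed d t - 2 * e / lam))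
          \<longlongrightarrow> exp (2 * lam * t) * (E t - 2 * e / lam)) (at_right 0)"
        using st by (intro tendsto_intros Ed_lim) auto
      have "\<forall>\<^sub>F d in at_right 0. d \<in> {0<..<min d0 (l / 2)}"
        using d0 l by (intro eventually_at_right_real) auto
      then show "\<forall>\<^sub>F d in at_right 0. exp (2 * lam * t) * (Ed d t - 2 * e / lam)
          \<le> exp (2 * lam * s) * (Ed d s - 2 * e / lam)"
        by eventually_elim (auto intro!: step)
    qed simp
  qed

  show ?thesis
  proof (rule tendsto_le)
    show "((\<lambda>e. exp (2 * lam * s) * (E s - 2 * e / lam)) \<longlongrightarrow> exp (2 * lam * s) * E s) (at_right 0)"
      using lam by (auto intro!: tendsto_eq_intros)
    show "((\<lambda>e. exp (2 * lam * t) * (E t - 2 * e / lam)) \<longlongrightarrow> exp (2 * lam * t) * E t) (at_right 0)"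
      using lam by (auto intro!: tendsto_eq_intros)
    show "\<forall>\<^sub>F e in at_right 0. exp (2 * lam * t) * (E t - 2 * e / lam)
        \<le> exp (2 * lam * s) * (E s - 2 * e / lam)"
      using eventually_at_right_less[of 0] by eventually_elim (rule decay_eps)
  qed simp
qed

section \<open>Sign of the reaction term and nonnegative concentrations\<close>

lemma reaction_dissipative:
  fixes w c k n :: real
  assumes "k > 0" "n > 0" "0 \<le> c" "0 \<le> w + c"
  shows "0 \<le> w * (k * (w + c) powr n - k * c powr n)"
proof (cases "w \<ge> 0")
  case True
  then have "c powr n \<le> (w + c) powr n"
    using assms by (intro powr_mono2) auto
  then show ?thesis
    using True assms by (intro mult_nonneg_nonneg) auto
next
  case False
  then have "(w + c) powr n \<le> c powr n"
    using assms by (intro powr_mono2) auto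
  then show ?thesis
    using False assms by (intro mult_nonpos_nonpos) auto
qed

text \<open>
  A negative value would persist on a nonempty open set, which has positive measure. This
  upgrades the almost-everywhere sign of the concentration to a pointwise one, as needed for the
  energy balance at each fixed time.
\<close>

lemma AE_nonneg_continuous_imp_nonneg:
  fixes f :: "'a::euclidean_space \<Rightarrow> real"
  assumes S: "open S" and f: "continuous_on S f"
    and ae: "AE z in lborel. z \<in> S \<longrightarrow> 0 \<le> f z" and z: "z \<in> S"
  shows "0 \<le> f z"
proof (rule ccontr)
  let ?U = "S \<inter> f -` {..<0}"
  assume "\<not> 0 \<le> f z"
  then have "?U \<noteq> {}"
    using z by auto
  moreover have U: "open ?U"
    using f S by (intro continuous_open_preimage) auto
  ultimately have "\<not> negligible ?U"
    by (intro open_not_negligible)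
  moreover have "?U \<in> null_sets lborel"
  proof -
    have "AE z in lborel. z \<notin> ?U"
      using ae by eventually_elim auto
    then show ?thesis
      using U by (subst AE_iff_null_sets) auto
  qed
  ultimately show False
    by (auto simp: negligible_iff_null_sets intro: null_sets_completionI)
qed

section \<open>Exponential stability\<close>

theorem theorem4p3:
  fixes l D v k n \<alpha> ubar rho0 :: real and C :: "real \<Rightarrow> real"
  assumes "l > 0" and "D > 0" and "v > 0" and "k > 0" and "n > 0"
    and "0 \<le> \<alpha>" and "\<alpha> \<le> 1 / 2"
    and "rho0 > 0"
    and "ubar > 0"
    and "steady_state l D v k n ubar C"
    and "\<forall>x\<in>{0..l}. C x \<ge> 0"
  shows "\<exists>K lam. K \<ge> 1 \<and> lam > 0 \<and>
    (\<forall>T > 0. \<forall>w uw.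
       deviation_solution (rho rho0 D v) l T D v k n C uw w \<and>
       nonneg_concentration l T C w \<and>
       (\<forall>t\<in>{0<..<T}. uw t = \<alpha> * w 0 t) \<longrightarrow>
       (\<forall>t\<in>{0..T}.
          norm_L2w (rho rho0 D v) l (\<lambda>x. w x t)
            \<le> K * exp (- lam * t) * norm_L2w (rho rho0 D v) l (\<lambda>x. w x 0)))"
proof -
  define lam where "lam = v\<^sup>2 / (8 * D)"
  have lam: "lam > 0"
    using assms by (simp add: lam_def)
  let ?r = "rho rho0 D v"
  have r: "\<And>x. 0 \<le> ?r x" "continuous_on UNIV ?r"
    using assms by (auto intro: rho_nonneg continuous_on_rho[OF continuous_on_id])
  have contC: "continuous_on {0..l} C"
    using assms(10) unfolding steady_state_def by (auto intro: DERIV_continuous_on)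

  have "norm_L2w ?r l (\<lambda>x. w x t) \<le> exp (- lam * t) * norm_L2w ?r l (\<lambda>x. w x 0)"
    if T: "T > 0" and sol: "deviation_solution ?r l T D v k n C uw w"
      and nonneg: "nonneg_concentration l T C w"
      and uw: "\<forall>t\<in>{0<..<T}. uw t = \<alpha> * w 0 t" and t: "t \<in> {0..T}"
    for T w uw t
  proof -
    obtain w_t w_x w_xx where
      wx: "\<forall>x\<in>{0..l}. \<forall>t\<in>{0<..<T}.
           ((\<lambda>y. w y t) has_real_derivative w_x x t) (at x within {0..l})" and
      wxx_wt: "\<forall>x\<in>{0<..<l}. \<forall>t\<in>{0<..<T}.
           ((\<lambda>y. w_x y t) has_real_derivative w_xx x t) (at x) \<and>
           ((\<lambda>s. w x s) has_real_derivative w_t x t) (at t)" and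
      cw: "continuous_on ({0..l} \<times> {0<..<T}) (\<lambda>(x, t). w x t)" and
      cwx: "continuous_on ({0..l} \<times> {0<..<T}) (\<lambda>(x, t). w_x x t)" and
      cwt: "continuous_on ({0<..<l} \<times> {0<..<T}) (\<lambda>(x, t). w_t x t)" and
      pde: "\<forall>x\<in>{0<..<l}. \<forall>t\<in>{0<..<T}.
           w_t x t = D * w_xx x t - v * w_x x t + k * C x powr n - k * (w x t + C x) powr n" and
      inlet: "\<forall>t\<in>{0<..<T}. w 0 t = uw t + D / v * w_x 0 t" and
      outlet: "\<forall>t\<in>{0<..<T}. w_x l t = 0"
      using sol unfolding deviation_solution_def by blast
    have L2: "\<forall>t\<in>{0..T}. in_L2w ?r l (\<lambda>x. w x t)"
      and L2_cont: "\<forall>s\<in>{0..T}.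
        ((\<lambda>t. norm_L2w ?r l (\<lambda>x. w x t - w x s)) \<longlongrightarrow> 0) (at s within {0..T})"
      using sol unfolding deviation_solution_def by blast+

    have conc: "0 \<le> w x \<tau> + C x" if "x \<in> {0<..<l}" "\<tau> \<in> {0<..<T}" for x \<tau>
    proof -
      have "continuous_on ({0<..<l} \<times> {0<..<T}) (\<lambda>z. w (fst z) (snd z))"
        by (rule continuous_on_subset[OF cw[unfolded case_prod_unfold]]) auto
      moreover have "continuous_on ({0<..<l} \<times> {0<..<T}) (\<lambda>z. C (fst z))"
        by (rule continuous_on_compose2[OF contC]) (auto intro!: continuous_intros)
      ultimately have "0 \<le> w (fst (x, \<tau>)) (snd (x, \<tau>)) + C (fst (x, \<tau>))"
        using nonneg that unfolding nonneg_concentration_def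
        by (intro AE_nonneg_continuous_imp_nonneg[where S = "{0<..<l} \<times> {0<..<T}"])
          (auto intro!: open_Times continuous_intros simp: case_prod_unfold mem_Times_iff)
      then show ?thesis by simp
    qed

    let ?N = "\<lambda>\<tau>. norm_L2w ?r l (\<lambda>x. w x \<tau>)"
    have N_energy: "(?N \<tau>)\<^sup>2 = integral {0..l} (\<lambda>x. ?r x * (w x \<tau>)\<^sup>2)" if "\<tau> \<in> {0<..<T}" for \<tau>
      using L2 that unfolding norm_L2w_power2[OF r(1)] in_L2w_def integral_open_interval_real
      by (intro set_lebesgue_integral_eq_integral(2)) auto
    have N_nonneg: "0 \<le> ?N \<tau>" for \<tau>
      using r(1) by (simp add: norm_L2w_def set_lebesgue_integral_def)

    \<comment> \<open>The rescaled norm is nonincreasing on the open time interval, and continuous on the closed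
      one; both end points are then reached by one-sided limits.\<close>
    let ?g = "\<lambda>\<tau>. exp (lam * \<tau>) * ?N \<tau>"
    have g_decr: "?g t \<le> ?g s" if st: "0 < s" "s \<le> t" "t < T" for s t
    proof -
      have "exp (2 * lam * t) * integral {0..l} (\<lambda>x. ?r x * (w x t)\<^sup>2)
          \<le> exp (2 * lam * s) * integral {0..l} (\<lambda>x. ?r x * (w x s)\<^sup>2)"
        unfolding lam_def
      proof (rule weighted_energy_decay[OF assms(1,2,3,8,7) st, where w_x = w_x and w_xx = w_xx
            and w_t = w_t and q = "\<lambda>x \<tau>. k * (w x \<tau> + C x) powr n - k * C x powr n"])
        fix x \<tau>
        assume x: "x \<in> {0<..<l}" and \<tau>: "\<tau> \<in> {0<..<T}"
        have "at x within {0..l} = at x"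
          using x by (intro at_within_interior) auto
        moreover have "((\<lambda>y. w y \<tau>) has_real_derivative w_x x \<tau>) (at x within {0..l})"
          using wx x \<tau> by auto
        ultimately show "((\<lambda>y. w y \<tau>) has_real_derivative w_x x \<tau>) (at x)"
          by simp
        show "((\<lambda>y. w_x y \<tau>) has_real_derivative w_xx x \<tau>) (at x)"
          "((\<lambda>s. w x s) has_real_derivative w_t x \<tau>) (at \<tau>)"
          using wxx_wt x \<tau> by auto
        show "w_t x \<tau> = D * w_xx x \<tau> - v * w_x x \<tau> - (k * (w x \<tau> + C x) powr n - k * C x powr n)"
          using pde x \<tau> by simp
        show "0 \<le> w x \<tau> * (k * (w x \<tau> + C x) powr n - k * C x powr n)"
          using assms x conc[OF x \<tau>] by (intro reaction_dissipative) auto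
      next
        fix \<tau>
        assume \<tau>: "\<tau> \<in> {0<..<T}"
        show "w 0 \<tau> = \<alpha> * w 0 \<tau> + D / v * w_x 0 \<tau>"
          using inlet uw \<tau> by metis
        show "w_x l \<tau> = 0"
          using outlet \<tau> by blast
      qed (fact cw cwx cwt)+
      then have "exp (2 * lam * t) * (?N t)\<^sup>2 \<le> exp (2 * lam * s) * (?N s)\<^sup>2"
        using st by (simp add: N_energy)
      moreover have "exp (2 * lam * \<tau>) = (exp (lam * \<tau>))\<^sup>2" for \<tau>
        by (simp add: exp_double[symmetric] mult_ac)
      ultimately have "(?g t)\<^sup>2 \<le> (?g s)\<^sup>2"
        by (simp add: power_mult_distrib)
      then show ?thesis
        by (rule power2_le_imp_le) (simp add: N_nonneg)
    qed

    have g_lim: "(?g \<longlongrightarrow> ?g s) (at s within {0..T})" if "s \<in> {0..T}" for s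
      using that L2_cont by (intro tendsto_intros norm_L2w_tendsto[OF r L2]) auto

    have g_le_init: "?g \<tau> \<le> ?g 0" if \<tau>: "\<tau> \<in> {0<..<T}" for \<tau>
    proof (rule tendsto_lowerbound)
      show "(?g \<longlongrightarrow> ?g 0) (at_right 0)"
        using g_lim[of 0] T at_within_Icc_at_right[of 0 T] by simp
      have "\<forall>\<^sub>F s in at_right 0. s \<in> {0<..<\<tau>}"
        using \<tau> by (intro eventually_at_right_real) auto
      then show "\<forall>\<^sub>F s in at_right 0. ?g \<tau> \<le> ?g s"
        by eventually_elim (use \<tau> in \<open>auto intro!: g_decr\<close>)
    qed simp
    have "?g T \<le> ?g 0"
    proof (rule tendsto_upperbound)
      show "(?g \<longlongrightarrow> ?g T) (at_left T)"
        using g_lim[of T] T at_within_Icc_at_left[of 0 T] by simp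
      have "\<forall>\<^sub>F s in at_left T. s \<in> {0<..<T}"
        using T by (intro eventually_at_left_real) auto
      then show "\<forall>\<^sub>F s in at_left T. ?g s \<le> ?g 0"
        by eventually_elim (rule g_le_init)
    qed simp
    with g_le_init t have "?g t \<le> ?g 0"
      by (cases "t = 0 \<or> t = T") auto
    then show ?thesis
      by (simp add: exp_minus field_simps)
  qed
  then show ?thesis
    using lam by (intro exI[of _ 1] exI[of _ lam]) auto
qed

end
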